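(* For all positive integers $h,\ell$ with $h>\ell+2$, the tensor product $\prod_{M_\partial\in DM_{h,\ell}}M_\partial^{\triangleleft}$ of the cones of all members of $DM_{h,\ell}$ is a core.
   Context: All digraphs are finite, without loops and parallel arcs; digons (pairs of opposite arcs) are allowed. A homomorphism is a vertex map sending arcs to arcs. The tensor product has as vertex set the Cartesian product, with an arc from $(u_i)_i$ to $(v_i)_i$ iff $u_i\to v_i$ is an arc in every coordinate. A digraph is a core if its only retract (endomorphism $\phi$ with $\phi^2=\phi$) is the identity. The cone $G^{\triangleleft}$ of a digraph $G$ is obtained by adding a new vertex joined by arcs in both directions to every vertex of $G$. For a sequence $\partial=(\partial_1,\dots,\partial_\ell)$ of integers with $1\le \partial_i\le h-2$, the mountain $M_\partial$ of height $h$ is the oriented path which, traversed from its beginning, consists of: one forward arc; then for $i=1,\dots,\ell$ in order, $\partial_i$ consecutive forward arcs followed by $\partial_i$ consecutive backward arcs (the $i$-th peak); then $h-2$ consecutive forward arcs; then one final forward arc. (A forward arc is oriented in the direction of traversal, a backward arc against it.) $DM_{h,\ell}$ is the set of all mountains $M_\partial$ of height $h$ with $\ell$ peaks such that $\partial_1>\partial_2>\dots>\partial_\ell\ge 1$ and $\partial_1=h-2$. *)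

theory Defs
  imports "Graph_Theory.Pair_Digraph" "HOL-Library.FuncSet"
begin

text \<open>
  Finite digraphs without loops and parallel arcs are records \<open>G\<close> of type
  \<^typ>\<open>'a pair_pre_digraph\<close> satisfying \<^term>\<open>pair_digraph G\<close>; digons are allowed.
\<close>

definition digraph_hom ::
  "('a \<Rightarrow> 'b) \<Rightarrow> 'a pair_pre_digraph \<Rightarrow> 'b pair_pre_digraph \<Rightarrow> bool" where
  "digraph_hom \<phi> G H \<longleftrightarrow>
     (\<forall>v \<in> pverts G. \<phi> v \<in> pverts H) \<and>
     (\<forall>(u, v) \<in> parcs G. (\<phi> u, \<phi> v) \<in> parcs H)"

definition retraction :: "('a \<Rightarrow> 'a) \<Rightarrow> 'a pair_pre_digraph \<Rightarrow> bool" where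
  "retraction \<phi> G \<longleftrightarrow> digraph_hom \<phi> G G \<and> (\<forall>v \<in> pverts G. \<phi> (\<phi> v) = \<phi> v)"

definition is_core :: "'a pair_pre_digraph \<Rightarrow> bool" where
  "is_core G \<longleftrightarrow> pair_digraph G \<and> (\<forall>\<phi>. retraction \<phi> G \<longrightarrow> (\<forall>v \<in> pverts G. \<phi> v = v))"

definition tensor_product ::
  "'i set \<Rightarrow> ('i \<Rightarrow> 'a pair_pre_digraph) \<Rightarrow> ('i \<Rightarrow> 'a) pair_pre_digraph" where
  "tensor_product I G =
     \<lparr> pverts = (\<Pi>\<^sub>E i\<in>I. pverts (G i)),
       parcs = {(u, v). u \<in> (\<Pi>\<^sub>E i\<in>I. pverts (G i)) \<and> v \<in> (\<Pi>\<^sub>E i\<in>I. pverts (G i)) \<and>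
                        (\<forall>i\<in>I. (u i, v i) \<in> parcs (G i))} \<rparr>"

text \<open>The new vertex of the cone is \<^const>\<open>None\<close>.\<close>

definition cone :: "'a pair_pre_digraph \<Rightarrow> 'a option pair_pre_digraph" where
  "cone G =
     \<lparr> pverts = insert None (Some ` pverts G),
       parcs = {(Some u, Some v) | u v. (u, v) \<in> parcs G}
             \<union> {(None, Some v) | v. v \<in> pverts G}
             \<union> {(Some v, None) | v. v \<in> pverts G} \<rparr>"

datatype direction = Forward | Backward

definition oriented_path :: "direction list \<Rightarrow> nat pair_pre_digraph" where
  "oriented_path s =
     \<lparr> pverts = {0..length s},
       parcs = {(i, Suc i) | i. i < length s \<and> s ! i = Forward}
             \<union> {(Suc i, i) | i. i < length s \<and> s ! i = Backward} \<rparr>"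

definition mountain :: "nat \<Rightarrow> nat list \<Rightarrow> nat pair_pre_digraph" where
  "mountain h ds = oriented_path
     ([Forward]
      @ concat (map (\<lambda>d. replicate d Forward @ replicate d Backward) ds)
      @ replicate (h - 2) Forward
      @ [Forward])"

text \<open>
  Different sequences give different digraphs on the vertices \<open>0, 1, \<dots>\<close>, and these are even
  pairwise non-isomorphic, so a product over this set has one factor for each sequence.
  The list is indexed from \<open>0\<close>, so \<open>ds ! 0\<close> is the height of the first peak.
\<close>

definition DM :: "nat \<Rightarrow> nat \<Rightarrow> nat pair_pre_digraph set" where
  "DM h l = {mountain h ds | ds.
     length ds = l \<and> (\<forall>d \<in> set ds. 1 \<le> d \<and> d \<le> h - 2) \<and>
     sorted_wrt (>) ds \<and> ds ! 0 = h - 2}"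

end

theory Submission
  imports Defs
begin

text \<open>
  Let \<open>\<phi>\<close> be an endomorphism of the product of the cones of \<open>(G i)\<close>. Two vertices span a digon iff the
  sets of coordinates in which they sit at the apex are complementary. Hence \<open>\<phi>\<close> induces a map \<open>f\<close> on
  subsets of the index set, which commutes with complements and preserves disjointness. For each
  \<open>j\<close> there is a bipartite digraph \<open>X\<close> that maps to every \<open>G i\<close> with \<open>i \<noteq> j\<close> but not to \<open>G j\<close>.
  Lifting it to the product, with coordinate \<open>j\<close> at the apex on one colour class, forces
  \<open>j \<in> f {j}\<close>, and therefore \<open>f\<close> is the identity. Lifting \<open>G i\<close> itself in the same way, with every
  other coordinate at the apex on one of the two colour classes, reduces \<open>\<phi> x i = x i\<close> to the
  rigidity of \<open>G i\<close>.

  For mountains, \<open>X\<close> is the mountain whose peak sequence concatenates all admissible sequences other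
  than the one of \<open>G j\<close>. A homomorphism preserves heights, so it goes from bottom to top, and each peak of
  \<open>X\<close> moves it by at most one valley. Since each block starts with the height \<open>h - 2\<close>, a block that
  does not traverse all peaks must leave it at one of the first two valleys.
\<close>

section \<open>Products of cones\<close>

definition two_colouring :: "('a \<Rightarrow> bool) \<Rightarrow> 'a pair_pre_digraph \<Rightarrow> bool" where
  "two_colouring c G \<longleftrightarrow> (\<forall>(u, v) \<in> parcs G. c u \<noteq> c v)"

lemma cone_simps [simp]:
  "None \<in> pverts (cone G)"
  "Some v \<in> pverts (cone G) \<longleftrightarrow> v \<in> pverts G"
  "(None, None) \<notin> parcs (cone G)"
  "(Some u, Some v) \<in> parcs (cone G) \<longleftrightarrow> (u, v) \<in> parcs G"
  "(None, Some v) \<in> parcs (cone G) \<longleftrightarrow> v \<in> pverts G"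
  "(Some v, None) \<in> parcs (cone G) \<longleftrightarrow> v \<in> pverts G"
  by (auto simp: cone_def)

lemma digraph_hom_comp:
  "digraph_hom \<phi> G H \<Longrightarrow> digraph_hom \<psi> H K \<Longrightarrow> digraph_hom (\<lambda>v. \<psi> (\<phi> v)) G K"
  by (fastforce simp: digraph_hom_def)

lemma digraph_hom_product_iff:
  "digraph_hom \<phi> X (tensor_product I G) \<longleftrightarrow>
     (\<forall>v \<in> pverts X. \<phi> v \<in> (\<Pi>\<^sub>E i\<in>I. pverts (G i))) \<and>
     (\<forall>(u, v) \<in> parcs X. \<phi> u \<in> (\<Pi>\<^sub>E i\<in>I. pverts (G i)) \<and> \<phi> v \<in> (\<Pi>\<^sub>E i\<in>I. pverts (G i)) \<and>
        (\<forall>i\<in>I. (\<phi> u i, \<phi> v i) \<in> parcs (G i)))"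
  by (auto simp: digraph_hom_def tensor_product_def)

lemma digraph_hom_product_coord:
  assumes "digraph_hom \<phi> X (tensor_product I G)" and "i \<in> I"
  shows "digraph_hom (\<lambda>v. \<phi> v i) X (G i)"
  using assms unfolding digraph_hom_product_iff
  by (auto simp: digraph_hom_def intro: PiE_mem)

lemma digraph_hom_cone_the:
  assumes hom: "digraph_hom \<phi> X (cone G)" and wf: "pair_wf_digraph X"
    and ne: "\<And>v. v \<in> pverts X \<Longrightarrow> \<phi> v \<noteq> None"
  shows "digraph_hom (\<lambda>v. the (\<phi> v)) X G"
  unfolding digraph_hom_def
proof (intro conjI ballI; clarify?)
  fix v assume "v \<in> pverts X"
  moreover from this obtain w where "\<phi> v = Some w" using ne by blast
  ultimately show "the (\<phi> v) \<in> pverts G" using hom by (force simp: digraph_hom_def)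
next
  fix u v assume uv: "(u, v) \<in> parcs X"
  then have "u \<in> pverts X" "v \<in> pverts X"
    using pair_wf_digraph.in_arcsD1[OF wf] pair_wf_digraph.in_arcsD2[OF wf] by blast+
  then obtain u' v' where "\<phi> u = Some u'" "\<phi> v = Some v'" using ne by blast
  then show "(the (\<phi> u), the (\<phi> v)) \<in> parcs G" using hom uv by (force simp: digraph_hom_def)
qed

text \<open>Through \<open>no_digon\<close>, every digon of the product comes from apex coordinates;
  \<open>colourable\<close> allows lifts that alternate between two apex sets, and
  \<open>has_arc\<close> realises disjoint apex sets at the two ends of an arc.\<close>

locale cone_family =
  fixes I :: "'i set" and G :: "'i \<Rightarrow> 'a pair_pre_digraph"
  assumes finite_index: "finite I"
    and index_nonempty: "I \<noteq> {}"
    and fin_digraph: "i \<in> I \<Longrightarrow> pair_fin_digraph (G i)"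
    and colourable: "i \<in> I \<Longrightarrow> \<exists>c. two_colouring c (G i)"
    and no_digon: "i \<in> I \<Longrightarrow> (u, v) \<in> parcs (G i) \<Longrightarrow> (v, u) \<notin> parcs (G i)"
    and has_arc: "i \<in> I \<Longrightarrow> \<exists>u v. (u, v) \<in> parcs (G i)"
begin

abbreviation P :: "('i \<Rightarrow> 'a option) pair_pre_digraph" where
  "P \<equiv> tensor_product I (\<lambda>i. cone (G i))"

section \<open>Apex sets and digons of the product\<close>

definition apexes :: "('i \<Rightarrow> 'a option) \<Rightarrow> 'i set" where
  "apexes x = {i \<in> I. x i = None}"

lemma wf_digraph: "i \<in> I \<Longrightarrow> pair_wf_digraph (G i)"
  using fin_digraph pair_fin_digraph.axioms(1) by blast

lemma arc_verts:
  "i \<in> I \<Longrightarrow> (u, v) \<in> parcs (G i) \<Longrightarrow> u \<in> pverts (G i) \<and> v \<in> pverts (G i)"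
  using wf_digraph pair_wf_digraph.in_arcsD1 pair_wf_digraph.in_arcsD2 by metis

lemma verts_P: "x \<in> pverts P \<longleftrightarrow> x \<in> (\<Pi>\<^sub>E i\<in>I. pverts (cone (G i)))"
  by (simp add: tensor_product_def)

lemma arcs_P: "(x, y) \<in> parcs P \<longleftrightarrow> x \<in> pverts P \<and> y \<in> pverts P \<and>
    (\<forall>i\<in>I. (x i, y i) \<in> parcs (cone (G i)))"
  by (simp add: tensor_product_def)

lemma pair_digraph_P: "pair_digraph P"
proof -
  have fin: "finite (pverts P)"
    using finite_index fin_digraph
    by (auto simp: tensor_product_def cone_def pair_fin_digraph.pair_finite_verts
        intro!: finite_PiE)
  have sub: "parcs P \<subseteq> pverts P \<times> pverts P" using arcs_P by auto
  \<comment> \<open>An empty product would be a single vertex with a loop, and a loop in a factor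
    would be its own reverse.\<close>
  have "(x, x) \<notin> parcs P" for x
  proof
    assume xx: "(x, x) \<in> parcs P"
    obtain i where i: "i \<in> I" using index_nonempty by blast
    then have "(x i, x i) \<in> parcs (cone (G i))" using xx arcs_P by blast
    then show False using no_digon[OF i] by (cases "x i") auto
  qed
  then show ?thesis
    using sub fin finite_subset[OF sub] by unfold_locales auto
qed

definition base :: "'i \<Rightarrow> 'a" where
  "base i = (SOME v. v \<in> pverts (G i))"

lemma base_in:
  assumes "i \<in> I"
  shows "base i \<in> pverts (G i)"
proof -
  have "\<exists>v. v \<in> pverts (G i)" using has_arc[OF assms] arc_verts[OF assms] by blast
  then show ?thesis unfolding base_def by (rule someI_ex)
qed

definition witness :: "'i set \<Rightarrow> 'i \<Rightarrow> 'a option" where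
  "witness A = (\<lambda>i\<in>I. if i \<in> A then None else Some (base i))"

lemma witness_in: "witness A \<in> pverts P"
  by (auto simp: verts_P witness_def base_in)

lemma apexes_witness: "A \<subseteq> I \<Longrightarrow> apexes (witness A) = A"
  by (auto simp: apexes_def witness_def)

lemma apexes_subset: "apexes x \<subseteq> I"
  by (auto simp: apexes_def)

lemma apexes_disjoint:
  assumes "(x, y) \<in> parcs P"
  shows "apexes x \<inter> apexes y = {}"
proof -
  have False if "i \<in> I" "x i = None" "y i = None" for i
  proof -
    have "(x i, y i) \<in> parcs (cone (G i))" using assms that(1) by (simp add: arcs_P)
    then show False by (simp add: that)
  qed
  then show ?thesis by (auto simp: apexes_def)
qed

text \<open>Since \<open>G i\<close> has no digon, arcs run both ways between two vertices of its
  cone exactly when one of them, and only one, is the apex.\<close>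

lemma digon_iff:
  assumes "x \<in> pverts P" "y \<in> pverts P"
  shows "(x, y) \<in> parcs P \<and> (y, x) \<in> parcs P \<longleftrightarrow> apexes y = I - apexes x"
proof -
  have "(x i, y i) \<in> parcs (cone (G i)) \<and> (y i, x i) \<in> parcs (cone (G i)) \<longleftrightarrow>
      (y i = None \<longleftrightarrow> x i \<noteq> None)" if i: "i \<in> I" for i
  proof -
    have "x i \<in> pverts (cone (G i))" "y i \<in> pverts (cone (G i))"
      using assms i by (auto simp: verts_P PiE_iff)
    then show ?thesis using no_digon[OF i] by (cases "x i"; cases "y i") auto
  qed
  then have "(x, y) \<in> parcs P \<and> (y, x) \<in> parcs P \<longleftrightarrow>
      (\<forall>i\<in>I. y i = None \<longleftrightarrow> x i \<noteq> None)"
    using assms unfolding arcs_P by blast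
  also have "\<dots> \<longleftrightarrow> apexes y = I - apexes x" unfolding apexes_def set_eq_iff by simp blast
  finally show ?thesis .
qed

text \<open>Along arcs of \<open>X\<close> the apex sets alternate between \<open>A\<close> and \<open>B\<close>, so the coordinates
  in \<open>A \<union> B\<close> impose no condition on \<open>X\<close>.\<close>

definition alternating ::
  "('b \<Rightarrow> bool) \<Rightarrow> 'i set \<Rightarrow> 'i set \<Rightarrow> ('i \<Rightarrow> 'a) \<Rightarrow> ('i \<Rightarrow> 'b \<Rightarrow> 'a) \<Rightarrow> 'b \<Rightarrow> 'i \<Rightarrow> 'a option" where
  "alternating c A B b \<psi> v = (\<lambda>i\<in>I.
     if i \<in> (if c v then A else B) then None
     else if i \<in> A \<union> B then Some (b i) else Some (\<psi> i v))"

lemma apexes_alternating: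
  "A \<subseteq> I \<Longrightarrow> B \<subseteq> I \<Longrightarrow> apexes (alternating c A B b \<psi> v) = (if c v then A else B)"
  by (auto simp: apexes_def alternating_def)

lemma alternating_hom:
  assumes c: "two_colouring c X" and wf: "pair_wf_digraph X"
    and AB: "A \<inter> B = {}"
    and b: "\<And>i. i \<in> A \<union> B \<Longrightarrow> i \<in> I \<Longrightarrow> b i \<in> pverts (G i)"
    and \<psi>: "\<And>i. i \<in> I - (A \<union> B) \<Longrightarrow> digraph_hom (\<psi> i) X (G i)"
  shows "digraph_hom (alternating c A B b \<psi>) X P"
proof -
  have verts: "alternating c A B b \<psi> v \<in> pverts P" if "v \<in> pverts X" for v
    using that b \<psi> by (auto simp: verts_P alternating_def digraph_hom_def)
  have "(alternating c A B b \<psi> u, alternating c A B b \<psi> v) \<in> parcs P"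
    if uv: "(u, v) \<in> parcs X" for u v
  proof -
    have "u \<in> pverts X" "v \<in> pverts X"
      using uv pair_wf_digraph.in_arcsD1[OF wf] pair_wf_digraph.in_arcsD2[OF wf] by blast+
    moreover have "c u \<noteq> c v" using c uv by (auto simp: two_colouring_def)
    moreover have "(\<psi> i u, \<psi> i v) \<in> parcs (G i)" if "i \<in> I" "i \<notin> A" "i \<notin> B" for i
      using \<psi>[of i] uv that by (auto simp: digraph_hom_def)
    ultimately have "(alternating c A B b \<psi> u i, alternating c A B b \<psi> v i) \<in> parcs (cone (G i))"
      if "i \<in> I" for i
      using that AB b by (auto simp: alternating_def)
    then show ?thesis using verts \<open>u \<in> pverts X\<close> \<open>v \<in> pverts X\<close> by (simp add: arcs_P)
  qed
  then show ?thesis using verts by (auto simp: digraph_hom_def)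
qed

end

section \<open>The map on index sets induced by an endomorphism\<close>

locale cone_family_endo = cone_family +
  fixes \<phi>
  assumes endo: "digraph_hom \<phi> P P"
begin

lemma endo_vert: "x \<in> pverts P \<Longrightarrow> \<phi> x \<in> pverts P"
  using endo by (auto simp: digraph_hom_def)

lemma endo_arc: "(x, y) \<in> parcs P \<Longrightarrow> (\<phi> x, \<phi> y) \<in> parcs P"
  using endo by (auto simp: digraph_hom_def)

text \<open>The choice of the representative \<open>witness A\<close> does not matter, by
  \<open>apexes_endo\<close>.\<close>

definition apex_map :: "'a set \<Rightarrow> 'a set" where
  "apex_map A = apexes (\<phi> (witness A))"

lemma apexes_compl:
  assumes "x \<in> pverts P" "y \<in> pverts P" "apexes y = I - apexes x"
  shows "apexes (\<phi> y) = I - apexes (\<phi> x)"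
  using assms digon_iff endo_arc endo_vert by metis

text \<open>Both \<open>x\<close> and the representative of its apex set span a digon with the
  representative of the complement. Digons are preserved, so both images have the complementary apex
  set of one and the same vertex.\<close>

lemma apexes_endo:
  assumes "x \<in> pverts P"
  shows "apexes (\<phi> x) = apex_map (apexes x)"
proof -
  let ?y = "witness (I - apexes x)" and ?x = "witness (apexes x)"
  have "apexes (\<phi> x) = I - apexes (\<phi> ?y)" "apexes (\<phi> ?x) = I - apexes (\<phi> ?y)"
    using assms apexes_subset[of x]
    by (intro apexes_compl; force simp: witness_in apexes_witness)+
  then show ?thesis by (simp add: apex_map_def)
qed

lemma apex_map_compl:
  assumes "A \<subseteq> I"
  shows "apex_map (I - A) = I - apex_map A"
  unfolding apex_map_def using assms
  by (intro apexes_compl) (auto simp: witness_in apexes_witness)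

text \<open>Disjoint sets occur as the apex sets of the ends of an arc: coordinates outside both
  sets follow a fixed arc of \<open>G i\<close>, the others have exactly one end at the apex. The
  image of this arc is again an arc.\<close>

lemma apex_map_disjoint:
  assumes A: "A \<subseteq> I" and B: "B \<subseteq> I" and AB: "A \<inter> B = {}"
  shows "apex_map A \<inter> apex_map B = {}"
proof -
  obtain s t where st: "\<And>i. i \<in> I \<Longrightarrow> (s i, t i) \<in> parcs (G i)" using has_arc by metis
  define x where "x = (\<lambda>i\<in>I. if i \<in> A then None else Some (s i))"
  define y where "y = (\<lambda>i\<in>I. if i \<in> B then None else Some (t i))"
  have "x \<in> pverts P" "y \<in> pverts P"
    using st arc_verts by (force simp: x_def y_def verts_P)+
  moreover from this have "(x, y) \<in> parcs P"
    using st arc_verts AB by (force simp: x_def y_def arcs_P)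
  moreover have "apexes x = A" "apexes y = B" using A B by (auto simp: x_def y_def apexes_def)
  ultimately show ?thesis using apexes_disjoint[OF endo_arc] apexes_endo by metis
qed

text \<open>This turns \<open>\<phi>\<close> into homomorphisms to single factors: all vertices of
  the lifted \<open>X\<close> have apex set \<open>A\<close> or \<open>B\<close>, so coordinate
  \<open>j\<close> of their images never meets the apex.\<close>

lemma alternating_endo_coord:
  assumes c: "two_colouring c X" and wf: "pair_wf_digraph X"
    and sub: "A \<subseteq> I" "B \<subseteq> I" and AB: "A \<inter> B = {}"
    and b: "\<And>i. i \<in> A \<union> B \<Longrightarrow> b i \<in> pverts (G i)"
    and \<psi>: "\<And>i. i \<in> I - (A \<union> B) \<Longrightarrow> digraph_hom (\<psi> i) X (G i)"
    and j: "j \<in> I" "j \<notin> apex_map A" "j \<notin> apex_map B"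
  shows "digraph_hom (\<lambda>v. the (\<phi> (alternating c A B b \<psi> v) j)) X (G j)"
proof (rule digraph_hom_cone_the[OF _ wf])
  have hom: "digraph_hom (alternating c A B b \<psi>) X P"
    using assms by (intro alternating_hom) auto
  show "digraph_hom (\<lambda>v. \<phi> (alternating c A B b \<psi> v) j) X (cone (G j))"
    by (rule digraph_hom_product_coord[OF digraph_hom_comp[OF hom endo] j(1)])
  fix v assume "v \<in> pverts X"
  then have "alternating c A B b \<psi> v \<in> pverts P" using hom by (auto simp: digraph_hom_def)
  then have "j \<notin> apexes (\<phi> (alternating c A B b \<psi> v))"
    using j sub by (simp add: apexes_endo apexes_alternating)
  then show "\<phi> (alternating c A B b \<psi> v) j \<noteq> None" using j by (auto simp: apexes_def)
qed

end

section \<open>A criterion for a product of cones to be a core\<close>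

theorem (in cone_family) product_of_cones_is_core:
  assumes rigid: "\<And>i \<psi> v. i \<in> I \<Longrightarrow> digraph_hom \<psi> (G i) (G i) \<Longrightarrow> v \<in> pverts (G i) \<Longrightarrow> \<psi> v = v"
    and separated: "\<And>j. j \<in> I \<Longrightarrow> \<exists>(X :: 'b pair_pre_digraph) c. pair_wf_digraph X \<and> two_colouring c X \<and>
      (\<forall>i \<in> I - {j}. \<exists>\<psi>. digraph_hom \<psi> X (G i)) \<and> (\<nexists>\<psi>. digraph_hom \<psi> X (G j))"
  shows "is_core P"
proof -
  have "\<phi> x = x" if "retraction \<phi> P" and x: "x \<in> pverts P" for \<phi> x
  proof -
    interpret cone_family_endo I G \<phi>
      using that by unfold_locales (simp add: retraction_def)
    have single: "j \<in> apex_map {j}" if j: "j \<in> I" for j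
    proof (rule ccontr)
      assume nin: "j \<notin> apex_map {j}"
      obtain X :: "'b pair_pre_digraph" and c where X: "pair_wf_digraph X" "two_colouring c X"
          "\<forall>i \<in> I - {j}. \<exists>\<psi>. digraph_hom \<psi> X (G i)" "\<nexists>\<psi>. digraph_hom \<psi> X (G j)"
        using separated[OF j] by blast
      then obtain \<psi> where \<psi>: "\<And>i. i \<in> I - {j} \<Longrightarrow> digraph_hom (\<psi> i) X (G i)" by metis
      \<comment> \<open>The empty set is disjoint from itself, hence so is its image.\<close>
      have "j \<notin> apex_map {}" using apex_map_disjoint[of "{}" "{}"]
        by auto
      then have "digraph_hom (\<lambda>v. the (\<phi> (alternating c {j} {} base \<psi> v) j)) X (G j)"
        using X(1,2) \<psi> j nin base_in by (intro alternating_endo_coord) auto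
      then show False using X(4) by blast
    qed
    \<comment> \<open>The images of \<open>{j}\<close> and of \<open>I - A\<close> are disjoint, and
      the latter is the complement of \<open>apex_map A\<close>.\<close>
    have ge: "A \<subseteq> apex_map A" if A: "A \<subseteq> I" for A
    proof
      fix j assume j: "j \<in> A"
      have "apex_map {j} \<inter> apex_map (I - A) = {}"
        using A j by (intro apex_map_disjoint) auto
      then show "j \<in> apex_map A" using single[of j] A j apex_map_compl[OF A] by blast
    qed
    \<comment> \<open>The inclusion for \<open>I - A\<close> is, after complementing, the reverse
      inclusion for \<open>A\<close>.\<close>
    have eq: "apex_map A = A" if A: "A \<subseteq> I" for A
      using ge[OF A] ge[of "I - A"] apex_map_compl[OF A] A apexes_subset
      unfolding apex_map_def by blast
    have "\<phi> x i = x i" if i: "i \<in> I" for i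
    proof (cases "x i")
      case None
      then show ?thesis using apexes_endo[OF x] eq[OF apexes_subset[of x]] i
        by (auto simp: apexes_def)
    next
      case (Some u)
      have u: "u \<in> pverts (G i)" using x i Some by (metis PiE_mem cone_simps(2) verts_P)
      obtain c where c: "two_colouring c (G i)" using colourable[OF i] by blast
      \<comment> \<open>The colouring is normalised so that \<open>u\<close> gets the colour whose
        apex set is \<open>A\<close>, the apex set of \<open>x\<close>.\<close>
      define c' where "c' v \<longleftrightarrow> (c v \<longleftrightarrow> c u)" for v
      have c': "two_colouring c' (G i)" using c by (auto simp: two_colouring_def c'_def)
      define A where "A = apexes x"
      define B where "B = I - A - {i}"
      \<comment> \<open>Coordinates in \<open>B\<close> are off the apex at \<open>u\<close>, so
        they must carry the entries of \<open>x\<close> for the lift to send \<open>u\<close> to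
        \<open>x\<close>; those in \<open>A\<close> are at the apex there, so any vertex will
        do.\<close>
      define b where "b k = (if k \<in> A then base k else the (x k))" for k
      have A: "A \<subseteq> I" "i \<notin> A" using apexes_subset Some by (auto simp: A_def apexes_def)
      have "B \<subseteq> I" by (auto simp: B_def)
      then have ap: "apex_map A = A" "apex_map B = B" using eq A(1) by blast+
      have xk: "x k = Some (the (x k))" if "k \<in> B" for k
        using that by (auto simp: B_def A_def apexes_def)
      have bB: "b k \<in> pverts (G k)" if "k \<in> B" for k
      proof -
        have "x k \<in> pverts (cone (G k))" using x that by (auto simp: verts_P B_def PiE_iff)
        then show ?thesis using xk[OF that] that by (metis B_def DiffD1 DiffD2 b_def cone_simps(2))
      qed
      let ?z = "alternating c' A B b (\<lambda>_ v. v)"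
      have I: "I - (A \<union> B) = {i}" using A i by (auto simp: B_def)
      have "digraph_hom (\<lambda>v. the (\<phi> (?z v) i)) (G i) (G i)"
      proof (rule alternating_endo_coord[OF c' wf_digraph[OF i]])
        show "b k \<in> pverts (G k)" if "k \<in> A \<union> B" for k
          using that bB[of k] A base_in[of k] by (cases "k \<in> A") (auto simp: b_def)
        show "digraph_hom (\<lambda>v. v) (G i) (G k)" if "k \<in> I - (A \<union> B)" for k
          using that unfolding I by (auto simp: digraph_hom_def)
      qed (use A ap i in \<open>auto simp: B_def\<close>)
      then have "the (\<phi> (?z u) i) = u" using rigid i u by blast
      moreover have "?z u = x"
      proof
        fix k
        show "?z u k = x k"
        proof (cases "k \<in> I")
          case True
          then consider "k \<in> A" | "k \<in> B" | "k = i" using I by blast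
          then show ?thesis
          proof cases
            case 1
            then show ?thesis by (simp add: alternating_def c'_def A_def apexes_def)
          next
            case 2
            then show ?thesis using xk[OF 2]
              by (simp add: alternating_def c'_def b_def B_def)
          next
            case 3
            then show ?thesis using True A Some by (auto simp: alternating_def c'_def B_def)
          qed
        next
          case False
          then show ?thesis using x by (auto simp: alternating_def verts_P PiE_def extensional_def)
        qed
      qed
      moreover have "i \<notin> apexes (\<phi> x)"
        using apexes_endo[OF x] ap A by (simp add: A_def)
      then have "\<phi> x i \<noteq> None" using i by (simp add: apexes_def)
      ultimately show ?thesis using Some by auto
    qed
    then show ?thesis using endo_vert[OF x] x
      unfolding verts_P by (blast intro: PiE_ext)
  qed
  then show ?thesis using pair_digraph_P by (auto simp: is_core_def)
qed

section \<open>Walks in oriented paths\<close>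

text \<open>The end pairs of homomorphic images of the oriented path with word \<open>s\<close>.
  Only the ends are kept, so that concatenating words becomes composing relations.\<close>

fun walks :: "'a pair_pre_digraph \<Rightarrow> direction list \<Rightarrow> ('a \<times> 'a) set" where
  "walks G [] = Id"
| "walks G (Forward # s) = parcs G O walks G s"
| "walks G (Backward # s) = (parcs G)\<inverse> O walks G s"

lemma walks_append: "walks G (s @ t) = walks G s O walks G t"
  by (induction G s rule: walks.induct) auto

lemma walks_replicate_Backward:
  "walks G (replicate p Backward) = (walks G (replicate p Forward))\<inverse>"
proof (induction p)
  case (Suc p)
  have "walks G (replicate (Suc p) Forward) = walks G (replicate p Forward @ [Forward])"
    by (simp add: replicate_append_same)
  then show ?case using Suc by (simp add: walks_append converse_relcomp del: replicate_Suc) simp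
qed auto

lemma verts_oriented_path: "v \<in> pverts (oriented_path s) \<longleftrightarrow> v \<le> length s"
  by (auto simp: oriented_path_def)

lemma arcs_oriented_path:
  "(u, v) \<in> parcs (oriented_path s) \<longleftrightarrow>
     v = Suc u \<and> u < length s \<and> s ! u = Forward \<or> u = Suc v \<and> v < length s \<and> s ! v = Backward"
  by (auto simp: oriented_path_def)

lemma pair_fin_digraph_oriented_path: "pair_fin_digraph (oriented_path s)"
proof -
  have "parcs (oriented_path s) \<subseteq> {0..length s} \<times> {0..length s}"
    by (auto simp: oriented_path_def)
  then have "finite (parcs (oriented_path s))" by (rule finite_subset) simp
  then show ?thesis by unfold_locales (auto simp: oriented_path_def)
qed

lemma two_colouring_oriented_path: "two_colouring even (oriented_path s)"
  by (auto simp: two_colouring_def arcs_oriented_path)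

lemma hom_oriented_path_imp_walks:
  assumes "digraph_hom \<phi> (oriented_path s) G"
  shows "(\<phi> 0, \<phi> (length s)) \<in> walks G s"
proof -
  have "(\<phi> 0, \<phi> k) \<in> walks G (take k s)" if "k \<le> length s" for k
    using that
  proof (induction k)
    case (Suc k)
    have "(\<phi> k, \<phi> (Suc k)) \<in> walks G [s ! k]"
      using assms Suc.prems
      by (cases "s ! k") (force simp: digraph_hom_def arcs_oriented_path)+
    then show ?case using Suc by (auto simp: take_Suc_conv_app_nth walks_append)
  qed simp
  then show ?thesis by fastforce
qed

text \<open>The empty word relates every element to itself, hence the assumption that
  \<open>u\<close> is a vertex.\<close>

lemma walks_imp_hom_oriented_path:
  assumes wf: "pair_wf_digraph G" and u: "u \<in> pverts G"
  shows "(u, v) \<in> walks G s \<Longrightarrow> \<exists>\<phi>. digraph_hom \<phi> (oriented_path s) G \<and> \<phi> (length s) = v"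
proof (induction s arbitrary: v rule: rev_induct)
  case Nil
  then show ?case using u
    by (auto simp: digraph_hom_def verts_oriented_path arcs_oriented_path intro!: exI[of _ "\<lambda>_. u"])
next
  case (snoc d s)
  then obtain w where w: "(u, w) \<in> walks G s" "(w, v) \<in> walks G [d]" by (auto simp: walks_append)
  obtain \<phi> where \<phi>: "digraph_hom \<phi> (oriented_path s) G" "\<phi> (length s) = w"
    using snoc.IH[OF w(1)] by blast
  have step: "d = Forward \<and> (w, v) \<in> parcs G \<or> d = Backward \<and> (v, w) \<in> parcs G"
    using w(2) by (cases d) auto
  then have v: "v \<in> pverts G"
    using pair_wf_digraph.in_arcsD1[OF wf] pair_wf_digraph.in_arcsD2[OF wf] by blast
  define \<psi> where "\<psi> = \<phi>(Suc (length s) := v)"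
  have "digraph_hom \<psi> (oriented_path (s @ [d])) G"
    unfolding digraph_hom_def
  proof (intro conjI ballI; clarify?)
    fix x assume "x \<in> pverts (oriented_path (s @ [d]))"
    then show "\<psi> x \<in> pverts G"
      using \<phi> v by (auto simp: \<psi>_def digraph_hom_def verts_oriented_path)
  next
    fix x y assume xy: "(x, y) \<in> parcs (oriented_path (s @ [d]))"
    show "(\<psi> x, \<psi> y) \<in> parcs G"
    proof (cases "(x, y) \<in> parcs (oriented_path s)")
      case True
      then have "x \<le> length s" "y \<le> length s" by (auto simp: arcs_oriented_path)
      then show ?thesis using True \<phi> by (auto simp: \<psi>_def digraph_hom_def)
    next
      case False
      then show ?thesis using xy step \<phi>(2)
        by (auto simp: \<psi>_def arcs_oriented_path nth_append less_Suc_eq split: if_splits)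
    qed
  qed
  moreover have "\<psi> (length (s @ [d])) = v" by (simp add: \<psi>_def)
  ultimately show ?case by blast
qed

lemma walks_factor:
  "(length a, length a + length b) \<in> walks (oriented_path (a @ b @ c)) b"
proof (induction b arbitrary: a)
  case (Cons d b)
  have "(length a, Suc (length a)) \<in> walks (oriented_path (a @ (d # b) @ c)) [d]"
    by (cases d) (auto simp: arcs_oriented_path nth_append)
  moreover have "(Suc (length a), length a + length (d # b)) \<in> walks (oriented_path (a @ (d # b) @ c)) b"
    using Cons[of "a @ [d]"] by simp
  ultimately show ?case
    using walks_append[of "oriented_path (a @ (d # b) @ c)" "[d]" b] by (metis append_Cons append_Nil relcomp.relcompI)
qed simp

text \<open>A directed walk in an oriented path cannot turn round, since it would have to recross
  the last arc against its direction. It therefore runs right over \<open>Forward\<close> letters or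
  left over \<open>Backward\<close> ones.\<close>

lemma walks_Forward_cases:
  assumes "(u, v) \<in> walks (oriented_path s) (replicate p Forward)"
  obtains "v = u + p" "\<And>i. i < p \<Longrightarrow> s ! (u + i) = Forward"
  | "u = v + p" "\<And>i. i < p \<Longrightarrow> s ! (v + i) = Backward"
proof -
  have "v = u + p \<and> (\<forall>i<p. s ! (u + i) = Forward) \<or> u = v + p \<and> (\<forall>i<p. s ! (v + i) = Backward)"
    using assms
  proof (induction p arbitrary: v)
    case (Suc p)
    then have "(u, v) \<in> walks (oriented_path s) (replicate p Forward @ [Forward])"
      by (simp add: replicate_append_same)
    then obtain w where w: "(u, w) \<in> walks (oriented_path s) (replicate p Forward)"
        and wv: "(w, v) \<in> parcs (oriented_path s)"
      by (auto simp: walks_append)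
    from Suc.IH[OF w] show ?case
    proof (elim disjE conjE)
      assume *: "w = u + p" "\<forall>i<p. s ! (u + i) = Forward"
      from wv show ?thesis unfolding arcs_oriented_path
      proof (elim disjE conjE)
        assume "v = Suc w" "s ! w = Forward"
        then show ?thesis using * by (auto simp: less_Suc_eq)
      next
        assume **: "w = Suc v" "s ! v = Backward"
        \<comment> \<open>Otherwise the last step of the run and this one would cross the same arc
          in opposite directions.\<close>
        have "p = 0"
        proof (rule ccontr)
          assume "p \<noteq> 0"
          then have "p - 1 < p" "u + (p - 1) = v" using * **(1) by auto
          then show False using * ** by (metis direction.distinct(1))
        qed
        then show ?thesis using * ** by auto
      qed
    next
      assume *: "u = w + p" "\<forall>i<p. s ! (w + i) = Backward"
      from wv show ?thesis unfolding arcs_oriented_path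
      proof (elim disjE conjE)
        assume **: "v = Suc w" "s ! w = Forward"
        have "p = 0" using *(2) **(2) by (cases p) auto
        then show ?thesis using * ** by auto
      next
        assume **: "w = Suc v" "s ! v = Backward"
        have "s ! (v + i) = Backward" if "i < Suc p" for i
          using that * ** by (cases i) auto
        then show ?thesis using * ** by auto
      qed
    qed
  qed simp
  then show ?thesis using that by blast
qed

text \<open>Both ends reach the turning point \<open>m\<close> by a directed walk of length
  \<open>p\<close>. If they come from the same side they coincide; otherwise they lie at distance
  \<open>p\<close> on either side of it.\<close>

lemma walks_peak_cases:
  assumes "(u, v) \<in> walks (oriented_path s) (replicate p Forward @ replicate p Backward)"
  obtains "v = u"
  | "v = u + 2 * p" "\<And>i. i < p \<Longrightarrow> s ! (u + i) = Forward" "\<And>i. i < p \<Longrightarrow> s ! (u + p + i) = Backward"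
  | "u = v + 2 * p" "\<And>i. i < p \<Longrightarrow> s ! (v + i) = Forward" "\<And>i. i < p \<Longrightarrow> s ! (v + p + i) = Backward"
proof -
  obtain m where um: "(u, m) \<in> walks (oriented_path s) (replicate p Forward)"
      and vm: "(v, m) \<in> walks (oriented_path s) (replicate p Forward)"
    using assms by (auto simp: walks_append walks_replicate_Backward)
  show ?thesis
    using um
  proof (cases rule: walks_Forward_cases)
    case 1
    note a = this
    from vm show ?thesis
    proof (cases rule: walks_Forward_cases)
      case 1
      then show ?thesis using a that(1) by simp
    next
      case 2
      then show ?thesis using a that(2) by simp
    qed
  next
    case 2
    note a = this
    from vm show ?thesis
    proof (cases rule: walks_Forward_cases)
      case 1
      then show ?thesis using a that(3) by simp
    next
      case 2
      then show ?thesis using a that(1) by simp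
    qed
  qed
qed

section \<open>Heights: \<open>net (take v s)\<close> is the height of the vertex \<open>v\<close>
  of \<open>oriented_path s\<close>\<close>

definition net :: "direction list \<Rightarrow> int" where
  "net s = (\<Sum>d\<leftarrow>s. if d = Forward then 1 else -1)"

lemma net_simps [simp]:
  "net [] = 0" "net (Forward # s) = 1 + net s" "net (Backward # s) = net s - 1"
  "net (s @ t) = net s + net t"
  "net (replicate p Forward) = int p" "net (replicate p Backward) = - int p"
  by (simp_all add: net_def sum_list_replicate)

lemma walks_net:
  "(u, v) \<in> walks (oriented_path s) t \<Longrightarrow> net (take v s) = net (take u s) + net t"
proof (induction "oriented_path s" t arbitrary: u rule: walks.induct)
  case (2 t)
  then obtain w where w: "(u, w) \<in> parcs (oriented_path s)" "(w, v) \<in> walks (oriented_path s) t"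
    by auto
  from w(1) have "net (take w s) = net (take u s) + 1"
    by (auto simp: arcs_oriented_path take_Suc_conv_app_nth)
  then show ?case using 2(1)[OF w(2)] by simp
next
  case (3 t)
  then obtain w where w: "(w, u) \<in> parcs (oriented_path s)" "(w, v) \<in> walks (oriented_path s) t"
    by auto
  from w(1) have "net (take u s) = net (take w s) + 1"
    by (auto simp: arcs_oriented_path take_Suc_conv_app_nth)
  then show ?case using 3(1)[OF w(2)] by simp
qed simp

section \<open>Mountains\<close>

definition peaks :: "nat list \<Rightarrow> direction list" where
  "peaks ds = concat (map (\<lambda>d. replicate d Forward @ replicate d Backward) ds)"

lemma peaks_simps [simp]:
  "peaks [] = []"
  "peaks (d # ds) = replicate d Forward @ replicate d Backward @ peaks ds"
  "peaks (ds @ es) = peaks ds @ peaks es"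
  by (simp_all add: peaks_def)

lemma length_peaks: "length (peaks ds) = 2 * sum_list ds"
  by (induction ds) auto

definition mountain_word :: "nat \<Rightarrow> nat list \<Rightarrow> direction list" where
  "mountain_word h ds = Forward # peaks ds @ replicate (h - 1) Forward"

text \<open>With truncated subtraction, the final runs of lengths \<open>h - 2\<close> and 1 merge
  into one of length \<open>h - 1\<close> only from \<open>h = 2\<close> on.\<close>

lemma mountain_eq: "2 \<le> h \<Longrightarrow> mountain h ds = oriented_path (mountain_word h ds)"
  by (cases h; cases "h - 1")
    (auto simp: mountain_def mountain_word_def peaks_def replicate_append_same)

lemma net_peaks [simp]: "net (peaks ds) = 0"
  by (induction ds) auto

lemma net_mountain_word: "1 \<le> h \<Longrightarrow> net (mountain_word h ds) = int h"
  by (simp add: mountain_word_def)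

lemma net_take_peaks:
  assumes "\<forall>d \<in> set ds. d \<le> m"
  shows "0 \<le> net (take k (peaks ds)) \<and> net (take k (peaks ds)) \<le> int m"
  using assms
proof (induction ds arbitrary: k)
  case (Cons d ds)
  have "0 \<le> net (take (k - d - d) (peaks ds)) \<and> net (take (k - d - d) (peaks ds)) \<le> int m"
    using Cons by simp
  moreover have "net (take k (peaks (d # ds))) =
      int (min k d) - int (min (k - d) d) + net (take (k - d - d) (peaks ds))"
    by simp
  moreover have "k - d - d = 0" if "k - d < d" using that by simp
  ultimately show ?case using Cons.prems
    by (cases "k - d < d") auto
qed simp

text \<open>The peaks stay between heights 1 and \<open>h - 1\<close>, thanks to the first arc and
  the bound \<open>h - 2\<close>. So the two ends are the only vertices of heights 0 and
  \<open>h\<close>.\<close>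

lemma net_take_mountain_word:
  assumes ds: "\<forall>d \<in> set ds. d \<le> h - 2" and h: "2 \<le> h"
    and k: "0 < k" "k < length (mountain_word h ds)"
  shows "0 < net (take k (mountain_word h ds)) \<and> net (take k (mountain_word h ds)) < int h"
proof -
  obtain j where j: "k = Suc j" using k by (cases k) auto
  have "net (take k (mountain_word h ds)) =
      1 + net (take j (peaks ds)) + int (min (j - length (peaks ds)) (h - 1))"
    by (simp add: j mountain_word_def)
  moreover have "0 \<le> net (take j (peaks ds)) \<and> net (take j (peaks ds)) \<le> int (h - 2)"
    using net_take_peaks[OF ds] .
  moreover have "net (take j (peaks ds)) = 0" if "length (peaks ds) \<le> j" using that by simp
  moreover have "j - length (peaks ds) < h - 1" using k j h by (auto simp: mountain_word_def)
  ultimately show ?thesis using h by (cases "length (peaks ds) \<le> j") auto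
qed

text \<open>A height difference of \<open>h\<close> is attained only between the bottom and the
  top.\<close>

lemma walks_mountain_endpoints:
  assumes ds: "\<forall>d \<in> set ds. d \<le> h - 2" and h: "2 \<le> h" and t: "net t = int h"
    and w: "(u, v) \<in> walks (oriented_path (mountain_word h ds)) t"
    and le: "u \<le> length (mountain_word h ds)" "v \<le> length (mountain_word h ds)"
  shows "u = 0" "v = length (mountain_word h ds)"
proof -
  let ?s = "mountain_word h ds"
  have eq: "net (take v ?s) = net (take u ?s) + int h" using walks_net[OF w] t by simp
  have end1: "net (take 0 ?s) = 0" by simp
  have end2: "net (take (length ?s) ?s) = int h" using h by (simp add: net_mountain_word)
  have "k = 0 \<and> net (take k ?s) = 0 \<or> k = length ?s \<and> net (take k ?s) = int h \<or>
      0 < net (take k ?s) \<and> net (take k ?s) < int h" if "k \<le> length ?s" for k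
    using net_take_mountain_word[OF ds h, of k] end1 end2 that by (metis le_neq_implies_less neq0_conv)
  from this[OF le(1)] this[OF le(2)] eq have "u = 0 \<and> v = length ?s"
    using h by (elim disjE conjE; simp)
  then show "u = 0" "v = length ?s" by simp_all
qed

lemma mountain_hom_endpoints:
  assumes ds: "\<forall>d \<in> set ds. d \<le> h - 2" and h: "2 \<le> h"
    and hom: "digraph_hom \<phi> (mountain h es) (mountain h ds)"
  shows "\<phi> 0 = 0" "\<phi> (length (mountain_word h es)) = length (mountain_word h ds)"
proof -
  have hom': "digraph_hom \<phi> (oriented_path (mountain_word h es)) (oriented_path (mountain_word h ds))"
    using hom h by (simp add: mountain_eq)
  then have "\<phi> 0 \<le> length (mountain_word h ds)"
    "\<phi> (length (mountain_word h es)) \<le> length (mountain_word h ds)"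
    by (auto simp: digraph_hom_def verts_oriented_path)
  then show "\<phi> 0 = 0" "\<phi> (length (mountain_word h es)) = length (mountain_word h ds)"
    using walks_mountain_endpoints[OF ds h _ hom_oriented_path_imp_walks[OF hom']] h
    by (simp_all add: net_mountain_word)
qed

lemma mountain_rigid:
  assumes ds: "\<forall>d \<in> set ds. d \<le> h - 2" and h: "2 \<le> h"
    and hom: "digraph_hom \<phi> (mountain h ds) (mountain h ds)"
    and v: "v \<in> pverts (mountain h ds)"
  shows "\<phi> v = v"
proof -
  let ?s = "mountain_word h ds"
  have step: "\<phi> (Suc k) = Suc (\<phi> k) \<or> \<phi> k = Suc (\<phi> (Suc k))" if "k < length ?s" for k
  proof -
    have "(k, Suc k) \<in> parcs (oriented_path ?s) \<or> (Suc k, k) \<in> parcs (oriented_path ?s)"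
      using that by (cases "?s ! k") (auto simp: arcs_oriented_path)
    then have "(\<phi> k, \<phi> (Suc k)) \<in> parcs (oriented_path ?s) \<or> (\<phi> (Suc k), \<phi> k) \<in> parcs (oriented_path ?s)"
      using hom h by (auto simp: digraph_hom_def mountain_eq)
    then show ?thesis by (auto simp: arcs_oriented_path)
  qed
  \<comment> \<open>A \<open>\<plusminus>1\<close> walk with \<open>n\<close> steps from \<open>0\<close> to \<open>n\<close> is the identity.\<close>
  have "\<phi> k \<le> k" if "k \<le> length ?s" for k
    using that
  proof (induction k)
    case 0
    then show ?case using mountain_hom_endpoints[OF ds h hom] by simp
  next
    case (Suc k)
    then show ?case using step[of k] by auto
  qed
  moreover have "k \<le> \<phi> k" if "k \<le> length ?s" for k
    using that
  proof (induction k rule: inc_induct)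
    case base
    then show ?case using mountain_hom_endpoints[OF ds h hom] by simp
  next
    case (step k)
    then show ?case using \<open>\<And>k. k < length ?s \<Longrightarrow> _\<close>[of k] by auto
  qed
  ultimately show ?thesis using v h by (simp add: mountain_eq verts_oriented_path eq_iff)
qed

section \<open>Admissible peak sequences and homomorphisms from their concatenations\<close>

definition admissible :: "nat \<Rightarrow> nat \<Rightarrow> nat list \<Rightarrow> bool" where
  "admissible h l ds \<longleftrightarrow> length ds = l \<and> (\<forall>d \<in> set ds. 1 \<le> d \<and> d \<le> h - 2) \<and>
     sorted_wrt (>) ds \<and> ds ! 0 = h - 2"

lemma DM_eq: "DM h l = mountain h ` {ds. admissible h l ds}"
  by (auto simp: DM_def admissible_def)

lemma finite_admissible: "finite {ds. admissible h l ds}"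
  by (rule finite_subset[OF _ finite_lists_length_eq[of "{..h - 2}" l]])
    (auto simp: admissible_def)

lemma admissible_exists:
  assumes "0 < l" "l + 2 < h"
  shows "\<exists>ds. admissible h l ds"
proof -
  \<comment> \<open>The heights are \<open>h - 2\<close>, then \<open>l - 1\<close> down to 1;
    \<open>l + 2 < h\<close> gives \<open>l - 1 < h - 2\<close>.\<close>
  have "admissible h l ((h - 2) # rev [1..<l])"
    using assms by (auto simp: admissible_def sorted_wrt_rev)
  then show ?thesis by blast
qed

text \<open>Peaks that are not needed are folded into a forward run of length \<open>m\<close> starting at the
  current vertex.\<close>

lemma walks_fold_peaks:
  assumes "\<forall>x \<in> set xs. x \<le> m"
  shows "(length a, length a) \<in> walks (oriented_path (a @ replicate m Forward @ c)) (peaks xs)"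
  using assms
proof (induction xs)
  case (Cons x xs)
  let ?G = "oriented_path (a @ replicate m Forward @ c)"
  have "replicate m Forward = replicate x Forward @ replicate (m - x) Forward"
    using Cons.prems by (simp flip: replicate_add)
  then have "(length a, length a + x) \<in> walks ?G (replicate x Forward)"
    using walks_factor[of a "replicate x Forward" "replicate (m - x) Forward @ c"] by simp
  then show ?case using Cons by (auto simp: walks_append walks_replicate_Backward)
qed simp

text \<open>Blocks before \<open>ds\<close> are folded at vertex 1 into the first ascent, which has
  the full length \<open>h - 2\<close>. The block \<open>ds\<close> is followed literally, and later
  blocks are folded into the final ascent.\<close>

lemma mountain_concat_hom:
  assumes h: "2 \<le> h" and l: "0 < l" and adm: "\<forall>es \<in> set L. admissible h l es" and ds: "ds \<in> set L"
  shows "\<exists>\<phi>. digraph_hom \<phi> (mountain h (concat L)) (mountain h ds)"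
proof -
  let ?s = "mountain_word h ds" and ?G = "oriented_path (mountain_word h ds)"
  obtain L1 L2 where L: "L = L1 @ ds # L2" using ds by (meson split_list)
  obtain ds' where ds': "ds = (h - 2) # ds'"
    using adm ds l by (cases ds) (auto simp: admissible_def)
  have small: "\<forall>x \<in> set (concat L1). x \<le> h - 2" "\<forall>x \<in> set (concat L2). x \<le> h - 1"
    using adm L by (force simp: admissible_def)+
  have "(0, 1) \<in> walks ?G [Forward]"
    using walks_factor[of "[]" "[Forward]"] by (simp add: mountain_word_def)
  moreover have "(1, 1) \<in> walks ?G (peaks (concat L1))"
    using walks_fold_peaks[OF small(1), of "[Forward]"] by (simp add: mountain_word_def ds')
  moreover have "(1, Suc (length (peaks ds))) \<in> walks ?G (peaks ds)"
    using walks_factor[of "[Forward]" "peaks ds"] by (simp add: mountain_word_def)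
  moreover have "(Suc (length (peaks ds)), Suc (length (peaks ds))) \<in> walks ?G (peaks (concat L2))"
    using walks_fold_peaks[OF small(2), of "Forward # peaks ds" "[]"] by (simp add: mountain_word_def)
  moreover have "(Suc (length (peaks ds)), length ?s) \<in> walks ?G (replicate (h - 1) Forward)"
    using walks_factor[of "Forward # peaks ds" "replicate (h - 1) Forward" "[]"]
    by (simp add: mountain_word_def)
  ultimately have "(0, length ?s) \<in> walks ?G
      ([Forward] @ peaks (concat L1) @ peaks ds @ peaks (concat L2) @ replicate (h - 1) Forward)"
    unfolding walks_append by blast
  also have "[Forward] @ peaks (concat L1) @ peaks ds @ peaks (concat L2) @ replicate (h - 1) Forward
      = mountain_word h (concat L)"
    by (simp add: mountain_word_def L)
  finally show ?thesis
    using walks_imp_hom_oriented_path[of ?G 0 "length ?s"] pair_fin_digraph_oriented_path h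
    by (auto simp: mountain_eq verts_oriented_path pair_fin_digraph.axioms(1))
qed

section \<open>Valleys, the vertices of height 1 before, between and after the peaks, and walks
  between them\<close>

definition valley :: "nat list \<Rightarrow> nat \<Rightarrow> nat" where
  "valley ds v = Suc (length (peaks (take v ds)))"

lemma valley_Suc: "v < length ds \<Longrightarrow> valley ds (Suc v) = valley ds v + 2 * ds ! v"
  by (simp add: valley_def length_peaks take_Suc_conv_app_nth)

lemma valley_0: "valley ds 0 = 1"
  by (simp add: valley_def)

lemma valley_mono: "v \<le> w \<Longrightarrow> valley ds v \<le> valley ds w"
proof -
  assume "v \<le> w"
  then have "take w ds = take v ds @ drop v (take w ds)"
    by (metis append_take_drop_id min.absorb1 take_take)
  then have "length (peaks (take w ds)) = length (peaks (take v ds)) + length (peaks (drop v (take w ds)))"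
    by (metis length_append peaks_simps(3))
  then show ?thesis by (simp add: valley_def)
qed

lemma mountain_word_split:
  assumes "v < length ds"
  shows "mountain_word h ds = (Forward # peaks (take v ds)) @ replicate (ds ! v) Forward @
    replicate (ds ! v) Backward @ peaks (drop (Suc v) ds) @ replicate (h - 1) Forward"
  using arg_cong[OF id_take_nth_drop[OF assms], of peaks] by (simp add: mountain_word_def)

lemma mountain_word_nth:
  "v < length ds \<Longrightarrow> i < ds ! v \<Longrightarrow> mountain_word h ds ! (valley ds v + i) = Forward"
  "v < length ds \<Longrightarrow> i < ds ! v \<Longrightarrow> mountain_word h ds ! (valley ds v + ds ! v + i) = Backward"
  "i < h - 1 \<Longrightarrow> mountain_word h ds ! (valley ds (length ds) + i) = Forward"
    apply (subst mountain_word_split[of v], assumption, simp add: valley_def nth_append)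
   apply (subst mountain_word_split[of v], assumption, simp add: valley_def nth_append)
  apply (simp add: mountain_word_def valley_def nth_append)
  done

text \<open>Only three slopes leaving a valley have at least \<open>h - 2\<close> arcs: the two
  sides of the first peak, at valleys 0 and 1, and the final ascent at valley \<open>l\<close>.
  Every other slope ends at a summit too early.\<close>

lemma walks_valley_ascent:
  assumes adm: "admissible h l ds" and h: "2 < h" and v: "v \<le> l"
    and w: "(valley ds v, y) \<in> walks (oriented_path (mountain_word h ds)) (replicate (h - 2) Forward)"
  shows "v \<le> 1 \<or> v = l"
proof (rule ccontr)
  assume "\<not> ?thesis"
  then have v': "1 < v" "v < length ds" using v adm by (auto simp: admissible_def)
  have less: "ds ! k < h - 2" if "0 < k" "k < length ds" for k
    using adm that sorted_wrt_nth_less[of "(>)" ds 0 k] by (auto simp: admissible_def)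
  have pos: "0 < ds ! k" if "k < length ds" for k
  proof -
    have "ds ! k \<in> set ds" using that by simp
    then show ?thesis using adm by (fastforce simp: admissible_def)
  qed
  from w show False
  proof (cases rule: walks_Forward_cases)
    case 1
    then show False using mountain_word_nth(2)[of v ds 0 h] pos[of v] less[of v] v' by auto
  next
    case 2
    let ?d = "ds ! (v - 1)"
    have "valley ds v = valley ds (v - 1) + 2 * ?d" using valley_Suc[of "v - 1" ds] v' by simp
    moreover have "0 < ?d" "?d < h - 2" using pos less v' by auto
    \<comment> \<open>This position is just beyond the summit to the left: a \<open>Forward\<close>
      letter, which a directed walk to the left cannot cross.\<close>
    ultimately have "y + (h - 3 - ?d) = valley ds (v - 1) + (?d - 1)" using 2(1) by linarith
    moreover have "h - 3 - ?d < h - 2" "v - 1 < length ds" "?d - 1 < ?d"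
      using \<open>0 < ?d\<close> v' h by linarith+
    ultimately show False
      using 2(2)[of "h - 3 - ?d"] mountain_word_nth(1)[of "v - 1" ds "?d - 1" h] by simp
  qed
qed

text \<open>A walk that moves must turn at the summit of an adjacent peak: turning earlier or later
  would contradict a letter of that peak. So \<open>p\<close> is its height and the walk ends at the
  next valley.\<close>

lemma walks_valley_peak:
  assumes pos: "\<forall>d \<in> set ds. 1 \<le> d" and v: "v \<le> length ds" and p: "1 \<le> p" "p < h - 1"
    and w: "(valley ds v, y) \<in> walks (oriented_path (mountain_word h ds))
      (replicate p Forward @ replicate p Backward)"
  obtains "y = valley ds v"
  | "v < length ds" "p = ds ! v" "y = valley ds (Suc v)"
  | "0 < v" "y = valley ds (v - 1)"
  using w
proof (cases rule: walks_peak_cases)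
  case 1
  then show ?thesis using that(1) by simp
next
  case 2
  \<comment> \<open>As \<open>p < h - 1\<close>, the turn would still lie inside the final ascent,
    which has no \<open>Backward\<close> letter.\<close>
  have "v \<noteq> length ds"
    using 2(3)[of 0] mountain_word_nth(3)[of p h ds] p by auto
  then have v': "v < length ds" using v by simp
  then have d: "0 < ds ! v" using bspec[OF pos nth_mem] by force
  have "p = ds ! v"
    using 2(2)[of "ds ! v"] 2(3)[of 0] mountain_word_nth(1)[OF v', of p h]
      mountain_word_nth(2)[OF v', of 0 h] d p(1)
    by (cases p "ds ! v" rule: linorder_cases) auto
  then show ?thesis using that(2) v' 2(1) valley_Suc[OF v'] by simp
next
  case 3
  have "v \<noteq> 0"
  proof
    assume "v = 0"
    then show False using 3(1) p by (simp add: valley_0)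
  qed
  then have v': "v - 1 < length ds" using v by simp
  let ?d = "ds ! (v - 1)"
  have d: "0 < ?d" using bspec[OF pos nth_mem[OF v']] by simp
  have val: "valley ds v = valley ds (v - 1) + 2 * ?d"
    using valley_Suc[OF v'] \<open>v \<noteq> 0\<close> by simp
  have "p = ?d"
  proof (cases p ?d rule: linorder_cases)
    case less
    then have "y + (p - 1) = valley ds (v - 1) + ?d + (?d - p - 1)" using val 3(1) p by linarith
    then show ?thesis
      using 3(2)[of "p - 1"] mountain_word_nth(2)[OF v', of "?d - p - 1" h] less p by simp
  next
    case greater
    then have "y + p + (p - ?d - 1) = valley ds (v - 1) + (?d - 1)" using val 3(1) d by linarith
    then show ?thesis
      using 3(3)[of "p - ?d - 1"] mountain_word_nth(1)[OF v', of "?d - 1" h] greater d by simp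
  qed
  then show ?thesis using that(3) val 3(1) \<open>v \<noteq> 0\<close> by simp
qed

text \<open>Each peak of \<open>b\<close> advances by at most one valley, and only when the heights
  agree. Reaching valley \<open>l\<close> with \<open>l\<close> peaks leaves no step to waste, so
  all heights of \<open>b\<close> and \<open>ds\<close> agree.\<close>

lemma walks_valley_block:
  assumes ds: "admissible h l ds" and b: "admissible h l b" and h: "2 < h" and v: "v \<le> 1" "v < l"
    and w: "(valley ds v, y) \<in> walks (oriented_path (mountain_word h ds)) (peaks b)"
  obtains k where "k \<le> l" "y = valley ds k" "k = l \<Longrightarrow> b = ds"
proof -
  let ?G = "oriented_path (mountain_word h ds)"
  have len: "length ds = l" "length b = l" using ds b by (auto simp: admissible_def)
  have pos: "\<forall>d \<in> set ds. 1 \<le> d" using ds by (auto simp: admissible_def)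
  have bk: "1 \<le> b ! k" "b ! k < h - 1" if "k < l" for k
  proof -
    have "b ! k \<in> set b" using that len by simp
    then show "1 \<le> b ! k" "b ! k < h - 1" using b h by (force simp: admissible_def)+
  qed
  have first: "ds ! 0 = h - 2" "b ! 0 = h - 2" using ds b by (auto simp: admissible_def)
  have less: "ds ! k < h - 2" if "0 < k" "k < l" for k
    using ds that sorted_wrt_nth_less[of "(>)" ds 0 k] by (auto simp: admissible_def)
  \<comment> \<open>The induction starts at 1, because \<open>k \<le> n\<close> may fail before the
    first peak when \<open>v = 1\<close>. That peak has height \<open>h - 2\<close> and cannot cross
    the lower second peak of \<open>ds\<close>, so the bound holds after it.\<close>
  have "\<exists>k \<le> n. y = valley ds k \<and> (k = n \<longrightarrow> take n b = take n ds)"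
    if "1 \<le> n" "n \<le> l" "(valley ds v, y) \<in> walks ?G (peaks (take n b))" for n y
    using that
  proof (induction n arbitrary: y rule: nat_induct_at_least)
    case base
    have one: "take 1 b = [h - 2]" "take 1 ds = [h - 2]"
      using first len v by (cases b; cases ds; auto)+
    have range: "v \<le> length ds" "1 \<le> h - 2" "h - 2 < h - 1" using v len h by auto
    have walk: "(valley ds v, y) \<in> walks ?G (replicate (h - 2) Forward @ replicate (h - 2) Backward)"
      using base one by simp
    from pos range walk show ?case
    proof (cases rule: walks_valley_peak)
      case 1
      then show ?thesis using v one by (intro exI[of _ v]) simp
    next
      case 2
      then have "v = 0" using less[of v] len by (cases v) auto
      then show ?thesis using 2 one by auto
    next
      case 3
      then show ?thesis using v one by (intro exI[of _ 0]) auto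
    qed
  next
    case (Suc n)
    have n: "n < l" using Suc.prems by simp
    then have "take (Suc n) b = take n b @ [b ! n]" using len by (simp add: take_Suc_conv_app_nth)
    then obtain z where z: "(valley ds v, z) \<in> walks ?G (peaks (take n b))"
        and zy: "(z, y) \<in> walks ?G (replicate (b ! n) Forward @ replicate (b ! n) Backward)"
      using Suc.prems by (auto simp: walks_append)
    obtain k where k: "k \<le> n" "z = valley ds k" "k = n \<longrightarrow> take n b = take n ds"
      using Suc.IH[OF _ z] n by auto
    have "k \<le> length ds" using k n len by simp
    from pos this bk[OF n] zy[unfolded k(2)] show ?case
    proof (cases rule: walks_valley_peak)
      case 1
      then show ?thesis using k by (intro exI[of _ k]) auto
    next
      case 2
      then show ?thesis using k n len
        by (intro exI[of _ "Suc k"]) (auto simp: take_Suc_conv_app_nth)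
    next
      case 3
      then show ?thesis using k by (intro exI[of _ "k - 1"]) auto
    qed
  qed
  from this[of l y] show ?thesis using w v len that by auto
qed

text \<open>Staying at valley 0 or 1 is an invariant of the blocks: a block other than
  \<open>ds\<close> stops before valley \<open>l\<close>, and the ascent that follows is possible
  only from the first two valleys.\<close>

lemma walks_valley_not_end:
  assumes ds: "admissible h l ds" and h: "2 < h"
    and L: "\<forall>b \<in> set L. admissible h l b \<and> b \<noteq> ds" and v: "v \<le> 1" "v < l"
  shows "(valley ds v, length (mountain_word h ds)) \<notin> walks (oriented_path (mountain_word h ds))
    (peaks (concat L) @ replicate (h - 1) Forward)"
  using L v
proof (induction L arbitrary: v)
  case Nil
  have len: "length ds = l" using ds by (auto simp: admissible_def)
  then have "ds ! v \<in> set ds" using Nil by simp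
  then have pos: "0 < ds ! v" using ds by (fastforce simp: admissible_def)
  \<comment> \<open>With no block left, the top is more than \<open>h - 1\<close> steps away from
    \<open>valley ds v\<close>.\<close>
  have "valley ds v < valley ds (Suc v)" using valley_Suc[of v ds] pos Nil len by simp
  also have "\<dots> \<le> valley ds l" using Nil by (intro valley_mono) simp
  finally have "valley ds v < valley ds l" .
  moreover have "length (mountain_word h ds) = valley ds l + (h - 1)"
    using len by (simp add: valley_def mountain_word_def)
  ultimately show ?case by (auto elim!: walks_Forward_cases)
next
  case (Cons b L)
  let ?G = "oriented_path (mountain_word h ds)" and ?n = "length (mountain_word h ds)"
  let ?r = "peaks (concat L) @ replicate (h - 1) Forward"
  show ?case
  proof
    assume "(valley ds v, ?n) \<in> walks ?G (peaks (concat (b # L)) @ replicate (h - 1) Forward)"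
    then obtain y where y: "(valley ds v, y) \<in> walks ?G (peaks b)" "(y, ?n) \<in> walks ?G ?r"
      by (auto simp: walks_append)
    have b: "admissible h l b" "b \<noteq> ds" using Cons.prems by auto
    obtain k where k: "k < l" "y = valley ds k"
      using walks_valley_block[OF ds b(1) h Cons.prems(2,3) y(1)] b(2) by (metis le_neq_implies_less)
    \<comment> \<open>What follows begins with \<open>h - 2\<close> forward steps in either case:
      the first peak of the next block, or the final ascent.\<close>
    obtain r where r: "?r = replicate (h - 2) Forward @ r"
    proof (cases L)
      case Nil
      have "h - 1 = (h - 2) + 1" using h by simp
      then have "replicate (h - 1) Forward = replicate (h - 2) Forward @ replicate 1 Forward"
        by (metis replicate_add)
      then show ?thesis using Nil that by simp
    next
      case (Cons b' L')
      have "admissible h l b'" using Cons.prems Cons by simp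
      then obtain c where "b' = (h - 2) # c" using \<open>v < l\<close> by (cases b') (auto simp: admissible_def)
      then show ?thesis using Cons that by simp
    qed
    then obtain z where "(y, z) \<in> walks ?G (replicate (h - 2) Forward)"
      using y(2) unfolding r walks_append by blast
    then have "k \<le> 1" using walks_valley_ascent[OF ds h, of k z] k by auto
    then show False using Cons.IH[of k] Cons.prems k y(2) by auto
  qed
qed

lemma mountain_concat_no_hom:
  assumes ds: "admissible h l ds" and h: "2 < h" and l: "0 < l"
    and L: "\<forall>b \<in> set L. admissible h l b \<and> b \<noteq> ds"
  shows "\<nexists>\<phi>. digraph_hom \<phi> (mountain h (concat L)) (mountain h ds)"
proof
  assume "\<exists>\<phi>. digraph_hom \<phi> (mountain h (concat L)) (mountain h ds)"
  then obtain \<phi> where hom: "digraph_hom \<phi> (mountain h (concat L)) (mountain h ds)" by blast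
  let ?s = "mountain_word h ds" and ?t = "mountain_word h (concat L)"
  have "\<forall>d \<in> set ds. d \<le> h - 2" using ds by (auto simp: admissible_def)
  then have "\<phi> 0 = 0" "\<phi> (length ?t) = length ?s"
    using mountain_hom_endpoints[OF _ _ hom] h by auto
  moreover have "(\<phi> 0, \<phi> (length ?t)) \<in> walks (oriented_path ?s) ?t"
    using hom h by (intro hom_oriented_path_imp_walks) (simp add: mountain_eq)
  ultimately have "(0, length ?s) \<in> walks (oriented_path ?s) ?t" by simp
  then obtain y where "(0, y) \<in> parcs (oriented_path ?s)"
      and y: "(y, length ?s) \<in> walks (oriented_path ?s) (peaks (concat L) @ replicate (h - 1) Forward)"
    by (auto simp: mountain_word_def)
  then have "y = valley ds 0" by (auto simp: arcs_oriented_path valley_0)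
  then show False using walks_valley_not_end[OF ds h L, of 0] y l by simp
qed

section \<open>The product over all mountains with decreasing peaks\<close>

theorem theorem42:
  fixes h l :: nat
  assumes "h > 0" and "l > 0" and "h > l + 2"
  shows "is_core (tensor_product (DM h l) cone)"
proof -
  have h: "2 < h" "2 \<le> h" using assms by auto
  interpret cone_family "DM h l" "\<lambda>G. G"
  proof (rule cone_family.intro)
    show "finite (DM h l)" by (simp add: DM_eq finite_admissible)
    show "DM h l \<noteq> {}" using admissible_exists[OF assms(2,3)] by (auto simp: DM_eq)
    fix M assume "M \<in> DM h l"
    then obtain s where M: "M = oriented_path (Forward # s)"
      using h by (auto simp: DM_eq mountain_eq mountain_word_def)
    show "pair_fin_digraph M" by (simp add: M pair_fin_digraph_oriented_path)
    show "\<exists>c. two_colouring c M" using two_colouring_oriented_path M by blast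
    have "(0, 1) \<in> parcs M" by (simp add: M arcs_oriented_path)
    then show "\<exists>u v. (u, v) \<in> parcs M" by blast
    show "(v, u) \<notin> parcs M" if "(u, v) \<in> parcs M" for u v
      using that by (auto simp: M arcs_oriented_path)
  qed
  show ?thesis
  proof (rule product_of_cones_is_core)
    fix M \<psi> v assume "M \<in> DM h l" "digraph_hom \<psi> M M" "v \<in> pverts M"
    then show "\<psi> v = v" using mountain_rigid[OF _ h(2)] by (auto simp: DM_eq admissible_def)
  next
    fix M assume "M \<in> DM h l"
    then obtain ds where ds: "M = mountain h ds" "admissible h l ds" by (auto simp: DM_eq)
    \<comment> \<open>Any enumeration of the other sequences serves. If there are none,
      \<open>?X\<close> is the directed path with \<open>h\<close> arcs.\<close>
    obtain L where L: "set L = {b. admissible h l b} - {ds}"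
      using finite_list[of "{b. admissible h l b} - {ds}"] finite_admissible by auto
    let ?X = "mountain h (concat L)"
    have "pair_wf_digraph ?X" "two_colouring even ?X"
      using h pair_fin_digraph_oriented_path two_colouring_oriented_path
      by (auto simp: mountain_eq pair_fin_digraph.axioms(1))
    moreover have "\<exists>\<psi>. digraph_hom \<psi> ?X N" if N: "N \<in> DM h l - {M}" for N
    proof -
      obtain b where "N = mountain h b" "b \<in> set L" using N ds L by (auto simp: DM_eq)
      then show ?thesis using mountain_concat_hom[OF h(2) assms(2)] L by auto
    qed
    moreover have "\<nexists>\<psi>. digraph_hom \<psi> ?X M"
      using mountain_concat_no_hom[OF ds(2) h(1) assms(2)] L ds(1) by auto
    ultimately show "\<exists>(X :: nat pair_pre_digraph) c. pair_wf_digraph X \<and> two_colouring c X \<and>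
        (\<forall>N \<in> DM h l - {M}. \<exists>\<psi>. digraph_hom \<psi> X N) \<and> (\<nexists>\<psi>. digraph_hom \<psi> X M)"
      by blast
  qed
qed

end
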